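(* Let $(B,+,\circ)$ be a skew brace and let $(A,+,\circ)$ be a sub skew brace of $B$. If $|B:A|_+$ and $|B:A|_\circ$ are both finite, then $|B:A|_+=|B:A|_\circ$.
   Context: A skew brace is a triple $(B,+,\circ)$ where $(B,+)$ and $(B,\circ)$ are (not necessarily abelian) groups with $a\circ(b+c)=a\circ b-a+a\circ c$ for all $a,b,c\in B$, where $-a$ is the inverse of $a$ in $(B,+)$ and $\circ$ takes precedence over $+$. A sub skew brace of $B$ is a subset $A$ that is a subgroup of both $(B,+)$ and $(B,\circ)$. $|B:A|_+$ and $|B:A|_\circ$ denote the index of $(A,+)$ in $(B,+)$ and of $(A,\circ)$ in $(B,\circ)$, respectively. *)

theory Defs
  imports "HOL-Algebra.Algebra"
begin

(* The ring record only supplies the signature: addition is the (not necessarily abelian)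
   group (B,+) and multiplication is the circle operation. The ring axioms are not assumed. *)
locale skew_brace =
  fixes B (structure)
  assumes add_group: "group (add_monoid B)"
    and circ_group: "group B"
    and brace_compat:
      "\<lbrakk>a \<in> carrier B; b \<in> carrier B; c \<in> carrier B\<rbrakk>
        \<Longrightarrow> a \<otimes> (b \<oplus> c) = ((a \<otimes> b) \<oplus> (\<ominus> a)) \<oplus> (a \<otimes> c)"

definition sub_skew_brace :: "'a set \<Rightarrow> ('a, 'b) ring_scheme \<Rightarrow> bool"
  where "sub_skew_brace A B \<longleftrightarrow> additive_subgroup A B \<and> subgroup A B"

end

theory Submission
  imports Defs
begin

text \<open>
  The index of a subgroup can be counted with left cosets. For elements \<open>a\<close>, \<open>b\<close> of a skew brace
  \<open>B\<close> put \<open>\<lambda>\<^sub>a(b) = - a + a \<circ> b\<close>; every \<open>\<lambda>\<^sub>a\<close> is an automorphism of \<open>(B, +)\<close>, and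
  \<open>\<lambda>\<^sub>a \<lambda>\<^sub>b = \<lambda>\<^bsub>a \<circ> b\<^esub>\<close>. Since \<open>a \<circ> S = a + \<lambda>\<^sub>a(S)\<close> for every set \<open>S\<close>, a subgroup \<open>C\<close> of
  \<open>(B, +)\<close> that is invariant under all \<open>\<lambda>\<^sub>a\<close> (a left ideal) is also a subgroup of \<open>(B, \<circ>)\<close>,
  and its additive left cosets are literally the same sets as its multiplicative ones.

  The intersection \<open>C\<close> of the images \<open>\<lambda>\<^sub>b(A)\<close> over all \<open>b\<close> is such a left ideal, and it lies in
  \<open>A\<close>. Its index is finite, and both finiteness hypotheses enter here: \<open>\<lambda>\<^sub>b(A)\<close> is recovered from
  the coset \<open>b \<circ> A = b + \<lambda>\<^sub>b(A)\<close> as its set of differences, so finiteness of the multiplicative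
  index leaves only finitely many images; each of them has the same additive index as \<open>A\<close>, and a
  finite intersection of subgroups of finite index has finite index.

  By the tower law, each of the two indices of \<open>A\<close> in \<open>B\<close>, multiplied by the number of cosets of
  \<open>C\<close> that partition \<open>A\<close>, gives the number of cosets of \<open>C\<close> in \<open>B\<close>. These two numbers
  of cosets of \<open>C\<close> do not depend on which group structure is used, and they are finite and positive.
\<close>

section \<open>Cosets in groups\<close>

context group
begin

lemma bij_betw_lcosets_rcosets:
  assumes "subgroup H G"
  shows "bij_betw (\<lambda>U. m_inv G ` U) (lcosets H) (rcosets H)"
proof -
  interpret H: subgroup H G by fact
  have inv_coset: "m_inv G ` (x <# H) = H #> inv x" if x: "x \<in> carrier G" for x
  proof
    show "m_inv G ` (x <# H) \<subseteq> H #> inv x"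
      using x by (auto simp: l_coset_def r_coset_def inv_mult_group)
    show "H #> inv x \<subseteq> m_inv G ` (x <# H)"
    proof
      fix y assume "y \<in> H #> inv x"
      then obtain h where h: "h \<in> H" "y = h \<otimes> inv x"
        by (auto simp: r_coset_def)
      then have "y = inv (x \<otimes> inv h)" using x by (simp add: inv_mult_group)
      moreover have "x \<otimes> inv h \<in> x <# H"
        using h(1) by (auto simp: l_coset_def)
      ultimately show "y \<in> m_inv G ` (x <# H)" by blast
    qed
  qed
  have "inj_on (\<lambda>U. m_inv G ` U) (Pow (carrier G))"
    by (rule inj_on_image_Pow, rule inj_onI) (metis inv_inv)
  then have "inj_on (\<lambda>U. m_inv G ` U) (lcosets H)"
    using lcosets_subset_PowG[OF assms] by (rule inj_on_subset)
  moreover have "(\<lambda>U. m_inv G ` U) ` (lcosets H) = rcosets H"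
  proof
    show "(\<lambda>U. m_inv G ` U) ` (lcosets H) \<subseteq> rcosets H"
      by (auto simp: LCOSETS_def inv_coset rcosetsI[OF H.subset])
    show "rcosets H \<subseteq> (\<lambda>U. m_inv G ` U) ` (lcosets H)"
    proof
      fix Y assume "Y \<in> rcosets H"
      then obtain x where x: "x \<in> carrier G" "Y = H #> x"
        by (auto simp: RCOSETS_def)
      then have "Y = m_inv G ` (inv x <# H)" by (simp add: inv_coset)
      moreover have "inv x <# H \<in> lcosets H" using x by (auto simp: LCOSETS_def)
      ultimately show "Y \<in> (\<lambda>U. m_inv G ` U) ` (lcosets H)" by blast
    qed
  qed
  ultimately show ?thesis by (simp add: bij_betw_def)
qed

text \<open>
  The tower law for indices. The number of cosets of \<open>K\<close> in \<open>H\<close> is written as the size of a set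
  of subsets of \<open>H\<close>, so that two group structures on one carrier can be compared by comparing such
  sets.
\<close>

lemma card_lcosets_tower:
  assumes H: "subgroup H G" and K: "subgroup K G" and KH: "K \<subseteq> H"
  shows "card (lcosets K) = card (lcosets H) * card ((\<lambda>h. h <# K) ` H)"
proof -
  interpret H: subgroup H G by fact
  interpret K: subgroup K G by fact
  have "\<exists>r. \<forall>U\<in>lcosets H. r U \<in> carrier G \<and> U = r U <# H"
    unfolding LCOSETS_def by (intro bchoice) auto
  then obtain r where r: "\<And>U. U \<in> lcosets H \<Longrightarrow> r U \<in> carrier G"
    and rU: "\<And>U. U \<in> lcosets H \<Longrightarrow> r U <# H = U"
    by metis
  let ?f = "\<lambda>(U, Y). r U <# Y"
  have img: "r U <# (h <# K) = (r U \<otimes> h) <# K" if "U \<in> lcosets H" "h \<in> H" for U h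
    using that r by (simp add: lcos_m_assoc K.subset)
  have "inj_on ?f ((lcosets H) \<times> (\<lambda>h. h <# K) ` H)"
  proof (rule inj_onI, clarsimp)
    fix U U' h h'
    assume U: "U \<in> lcosets H" "U' \<in> lcosets H" and h: "h \<in> H" "h' \<in> H"
      and eq: "r U <# (h <# K) = r U' <# (h' <# K)"
    have "r U \<otimes> h \<in> r U <# (h <# K)"
      using U h r img by (simp add: lcos_self K)
    then have "r U \<otimes> h \<in> (r U' \<otimes> h') <# K"
      using eq U h img by simp
    then obtain k where k: "k \<in> K" "r U \<otimes> h = r U' \<otimes> h' \<otimes> k"
      by (auto simp: l_coset_def)
    then have "r U \<otimes> h = r U' \<otimes> (h' \<otimes> k)" "h' \<otimes> k \<in> H"
      using U h r KH by (auto simp: m_assoc)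
    then have "r U \<otimes> h \<in> r U' <# H" by (auto simp: l_coset_def)
    moreover have "r U \<otimes> h \<in> r U <# H" using h by (auto simp: l_coset_def)
    ultimately have UU': "U = U'"
      using lcos_disjoint[OF H U] rU U by auto
    have "inv (r U) <# (r U <# (h <# K)) = inv (r U) <# (r U <# (h' <# K))"
      using eq UU' by simp
    moreover have "inv (r U) <# (r U <# (g <# K)) = g <# K" if "g \<in> H" for g
      using that U r by (simp add: lcos_m_assoc K.subset m_assoc[symmetric])
    ultimately show "U = U' \<and> h <# K = h' <# K" using UU' h by simp
  qed
  moreover have "?f ` ((lcosets H) \<times> (\<lambda>h. h <# K) ` H) = lcosets K"
  proof
    show "?f ` ((lcosets H) \<times> (\<lambda>h. h <# K) ` H) \<subseteq> lcosets K"
      using r by (force simp: img LCOSETS_def[of G K])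
    show "lcosets K \<subseteq> ?f ` ((lcosets H) \<times> (\<lambda>h. h <# K) ` H)"
    proof
      fix Y assume "Y \<in> lcosets K"
      then obtain x where x: "x \<in> carrier G" "Y = x <# K" by (auto simp: LCOSETS_def)
      define U where "U = x <# H"
      have U: "U \<in> lcosets H" using x by (auto simp: U_def LCOSETS_def)
      have "x \<in> r U <# H" using rU[OF U] x by (simp add: U_def lcos_self H)
      then obtain h where h: "h \<in> H" "x = r U \<otimes> h" by (auto simp: l_coset_def)
      then have "Y = ?f (U, h <# K)" using x img[OF U] by simp
      then show "Y \<in> ?f ` ((lcosets H) \<times> (\<lambda>h. h <# K) ` H)" using U h by blast
    qed
  qed
  ultimately have "bij_betw ?f ((lcosets H) \<times> (\<lambda>h. h <# K) ` H) (lcosets K)"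
    by (simp add: bij_betw_def)
  then show ?thesis
    by (metis bij_betw_same_card card_cartesian_product)
qed

text \<open>
  A coset of the intersection is the intersection of cosets of the members, and only finitely many
  cosets of members are available.
\<close>

lemma finite_lcosets_Inter:
  assumes "finite F" "F \<noteq> {}"
    and sub: "\<And>H. H \<in> F \<Longrightarrow> subgroup H G"
    and fin: "\<And>H. H \<in> F \<Longrightarrow> finite (lcosets H)"
  shows "finite (lcosets (\<Inter>F))"
proof -
  have "x <# \<Inter>F = (\<Inter>H\<in>F. x <# H)" if x: "x \<in> carrier G" for x
  proof
    show "x <# \<Inter>F \<subseteq> (\<Inter>H\<in>F. x <# H)" by (auto simp: l_coset_def)
    show "(\<Inter>H\<in>F. x <# H) \<subseteq> x <# \<Inter>F"
    proof
      fix y assume y: "y \<in> (\<Inter>H\<in>F. x <# H)"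
      then have "inv x \<otimes> y \<in> \<Inter>F"
        using subgroup.lcos_module_imp[OF sub is_group x] by blast
      moreover have "y \<in> carrier G"
        using y \<open>F \<noteq> {}\<close> subgroup.elemlcos_carrier[OF sub is_group x] by blast
      then have "y = x \<otimes> (inv x \<otimes> y)" using x by (simp add: m_assoc[symmetric])
      ultimately show "y \<in> x <# \<Inter>F" by (auto simp: l_coset_def)
    qed
  qed
  moreover have "(\<lambda>H. x <# H) ` F \<in> Pow (\<Union>H\<in>F. lcosets H)" if "x \<in> carrier G" for x
    using that by (auto simp: LCOSETS_def)
  ultimately have "x <# \<Inter>F \<in> Inter ` Pow (\<Union>H\<in>F. lcosets H)" if "x \<in> carrier G" for x
    using that by (metis image_eqI)
  then have "lcosets (\<Inter>F) \<subseteq> Inter ` Pow (\<Union>H\<in>F. lcosets H)"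
    by (auto simp only: LCOSETS_def[of G "\<Inter>F"])
  moreover have "finite (Inter ` Pow (\<Union>H\<in>F. lcosets H))"
    using \<open>finite F\<close> fin by blast
  ultimately show ?thesis by (rule finite_subset)
qed

lemma finite_lcosets_automorphic_image:
  assumes hom: "\<phi> \<in> hom G G" and surj: "\<phi> ` carrier G = carrier G"
    and "H \<subseteq> carrier G" and fin: "finite (lcosets H)"
  shows "finite (lcosets (\<phi> ` H))"
proof -
  have "\<phi> x <# \<phi> ` H = \<phi> ` (x <# H)" if "x \<in> carrier G" for x
    using that \<open>H \<subseteq> carrier G\<close> hom_mult[OF hom]
    by (force simp: l_coset_def)
  then have "lcosets (\<phi> ` H) \<subseteq> (\<lambda>U. \<phi> ` U) ` (lcosets H)"
    unfolding LCOSETS_def using surj by (auto simp: image_iff) (metis imageE)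
  then show ?thesis using fin by (meson finite_imageI finite_subset)
qed

lemma subgroup_differences_lcoset:
  assumes "subgroup H G" "x \<in> carrier G"
  shows "(\<lambda>(y, z). inv y \<otimes> z) ` ((x <# H) \<times> (x <# H)) = H"
proof -
  interpret H: subgroup H G by fact
  have eq: "inv (x \<otimes> h) \<otimes> (x \<otimes> k) = inv h \<otimes> k" if "h \<in> H" "k \<in> H" for h k
  proof -
    have "inv (x \<otimes> h) \<otimes> (x \<otimes> k) = inv h \<otimes> (inv x \<otimes> (x \<otimes> k))"
      using that assms(2) by (simp add: inv_mult_group m_assoc)
    also have "\<dots> = inv h \<otimes> k"
      using that assms(2) by (simp add: m_assoc[symmetric])
    finally show ?thesis .
  qed
  show ?thesis
  proof
    show "(\<lambda>(y, z). inv y \<otimes> z) ` ((x <# H) \<times> (x <# H)) \<subseteq> H"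
      by (auto simp: l_coset_def eq)
    show "H \<subseteq> (\<lambda>(y, z). inv y \<otimes> z) ` ((x <# H) \<times> (x <# H))"
    proof
      fix h assume h: "h \<in> H"
      have "h = inv (x \<otimes> \<one>) \<otimes> (x \<otimes> h)" using eq[OF H.one_closed h] h by simp
      moreover have "x \<otimes> \<one> \<in> x <# H" "x \<otimes> h \<in> x <# H"
        using h H.one_closed unfolding l_coset_def by blast+
      ultimately show "h \<in> (\<lambda>(y, z). inv y \<otimes> z) ` ((x <# H) \<times> (x <# H))"
        by (intro image_eqI[where x = "(x \<otimes> \<one>, x \<otimes> h)"]) simp_all
    qed
  qed
qed

end

section \<open>The lambda action\<close>

context skew_brace
begin

sublocale group B
  by (rule circ_group)

sublocale add: group "add_monoid B"
  rewrites "carrier (add_monoid B) = carrier B"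
    and "monoid.mult (add_monoid B) = ring.add B"
    and "one (add_monoid B) = ring.zero B"
    and "m_inv (add_monoid B) = a_inv B"
  by (rule add_group) (auto simp: a_inv_def)

definition lam :: "'a \<Rightarrow> 'a \<Rightarrow> 'a"
  where "lam a b = \<ominus> a \<oplus> (a \<otimes> b)"

lemma lam_closed [simp]: "a \<in> carrier B \<Longrightarrow> b \<in> carrier B \<Longrightarrow> lam a b \<in> carrier B"
  by (simp add: lam_def)

lemma mult_eq_add_lam:
  "a \<in> carrier B \<Longrightarrow> b \<in> carrier B \<Longrightarrow> a \<otimes> b = a \<oplus> lam a b"
  by (simp add: lam_def add.m_assoc[symmetric])

lemma lam_add:
  "\<lbrakk>a \<in> carrier B; b \<in> carrier B; c \<in> carrier B\<rbrakk>
    \<Longrightarrow> lam a (b \<oplus> c) = lam a b \<oplus> lam a c"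
  by (simp add: lam_def brace_compat add.m_assoc)

lemma lam_hom: "a \<in> carrier B \<Longrightarrow> lam a \<in> hom (add_monoid B) (add_monoid B)"
  by (auto simp: hom_def lam_add)

lemma lam_minus: "\<lbrakk>a \<in> carrier B; b \<in> carrier B\<rbrakk> \<Longrightarrow> lam a (\<ominus> b) = \<ominus> lam a b"
  using group_hom.hom_inv[of "add_monoid B" "add_monoid B" "lam a" b] lam_hom[of a] add_group
  by (simp add: group_hom_def group_hom_axioms_def a_inv_def)

lemma lam_zero: "a \<in> carrier B \<Longrightarrow> lam a \<zero> = \<zero>"
  using group_hom.hom_one[of "add_monoid B" "add_monoid B" "lam a"] lam_hom[of a] add_group
  by (simp add: group_hom_def group_hom_axioms_def)

lemma one_eq_zero: "\<one> = \<zero>"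
  using mult_eq_add_lam[of \<one> \<zero>] by (simp add: lam_zero)

lemma lam_one: "b \<in> carrier B \<Longrightarrow> lam \<one> b = b"
  by (simp add: lam_def) (simp add: one_eq_zero)

lemma lam_lam:
  assumes "a \<in> carrier B" "b \<in> carrier B" "c \<in> carrier B"
  shows "lam a (lam b c) = lam (a \<otimes> b) c"
proof -
  have "lam a (lam b c) = \<ominus> lam a b \<oplus> lam a (b \<otimes> c)"
    using assms by (simp add: lam_def[of b c] lam_add lam_minus)
  also have "\<dots> = \<ominus> (a \<otimes> b) \<oplus> (a \<oplus> lam a (b \<otimes> c))"
    using assms by (simp add: lam_def[of a b] add.inv_mult_group add.m_assoc)
  also have "\<dots> = lam (a \<otimes> b) c"
    using assms mult_eq_add_lam[of a "b \<otimes> c"] by (simp add: lam_def[of "a \<otimes> b"] m_assoc)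
  finally show ?thesis .
qed

lemma lam_surj:
  assumes "a \<in> carrier B"
  shows "lam a ` carrier B = carrier B"
proof
  show "lam a ` carrier B \<subseteq> carrier B" using assms by auto
  show "carrier B \<subseteq> lam a ` carrier B"
  proof
    fix x assume "x \<in> carrier B"
    then have "x = lam a (lam (inv a) x)" "lam (inv a) x \<in> carrier B"
      using assms by (simp_all add: lam_lam lam_one)
    then show "x \<in> lam a ` carrier B" by blast
  qed
qed

lemma mult_lcoset_eq_add_lcoset:
  assumes "b \<in> carrier B" "S \<subseteq> carrier B"
  shows "b <# S = b <#\<^bsub>add_monoid B\<^esub> lam b ` S"
  using assms by (auto simp: l_coset_def mult_eq_add_lam subset_iff)

lemma lam_image_subgroup:
  assumes "b \<in> carrier B" "subgroup A (add_monoid B)"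
  shows "subgroup (lam b ` A) (add_monoid B)"
  using group_hom.subgroup_img_is_subgroup[of "add_monoid B" "add_monoid B" "lam b" A]
    assms lam_hom[of b] add_group
  by (simp add: group_hom_def group_hom_axioms_def)

text \<open>
  The multiplicative coset \<open>b \<circ> A\<close> is an additive coset of the subgroup \<open>\<lambda>\<^sub>b(A)\<close>, and a
  subgroup is the set of differences of any of its cosets. So the image depends only on the coset.
\<close>

lemma finite_lam_images:
  assumes A: "subgroup A (add_monoid B)" and fin: "finite (lcosets A)"
  shows "finite ((\<lambda>b. lam b ` A) ` carrier B)"
proof -
  have sub: "A \<subseteq> carrier B" using subgroup.subset[OF A] by simp
  let ?d = "\<lambda>U. (\<lambda>(y, z). \<ominus> y \<oplus> z) ` (U \<times> U)"
  have "lam b ` A = ?d (b <# A)" if "b \<in> carrier B" for b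
    using that A sub
    by (simp add: mult_lcoset_eq_add_lcoset add.subgroup_differences_lcoset lam_image_subgroup)
  then have "(\<lambda>b. lam b ` A) ` carrier B \<subseteq> ?d ` (lcosets A)"
    by (auto simp: LCOSETS_def)
  then show ?thesis using fin by (meson finite_imageI finite_subset)
qed

section \<open>Left ideals\<close>

text \<open>
  Closure holds because \<open>a \<circ> b = a + \<lambda>\<^sub>a(b)\<close>, and the multiplicative inverse of \<open>a\<close> is
  \<open>- \<lambda>\<^sub>c(a)\<close>, where \<open>c\<close> is that same inverse.
\<close>

lemma left_ideal_subgroup:
  assumes C: "subgroup C (add_monoid B)"
    and inv: "\<And>b x. b \<in> carrier B \<Longrightarrow> x \<in> C \<Longrightarrow> lam b x \<in> C"
  shows "subgroup C B"
proof -
  interpret C: subgroup C "add_monoid B"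
    rewrites "carrier (add_monoid B) = carrier B"
      and "monoid.mult (add_monoid B) = ring.add B"
      and "one (add_monoid B) = ring.zero B"
      and "m_inv (add_monoid B) = a_inv B"
    by (rule C) (auto simp: a_inv_def)
  show ?thesis
  proof (rule subgroupI)
    show "C \<subseteq> carrier B" by (rule C.subset)
    show "C \<noteq> {}" using C.one_closed by blast
  next
    fix a b assume "a \<in> C" "b \<in> C"
    then show "a \<otimes> b \<in> C" by (simp add: mult_eq_add_lam inv)
  next
    fix a assume a: "a \<in> C"
    \<comment> \<open>The two neutral elements agree, so \<open>inv a \<otimes> a\<close> is also the additive neutral element.\<close>
    have "inv a \<oplus> lam (inv a) a = \<zero>"
      using a mult_eq_add_lam[of "inv a" a] by (simp add: one_eq_zero)
    then have "inv a = \<ominus> lam (inv a) a"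
      using a add.inv_equality[of "inv a" "lam (inv a) a"] by simp
    then show "inv a \<in> C" using a inv by (metis C.m_inv_closed C.mem_carrier inv_closed)
  qed
qed

lemma left_ideal_lam_image:
  assumes "C \<subseteq> carrier B"
    and inv: "\<And>b x. b \<in> carrier B \<Longrightarrow> x \<in> C \<Longrightarrow> lam b x \<in> C"
    and b: "b \<in> carrier B"
  shows "lam b ` C = C"
proof
  show "lam b ` C \<subseteq> C" using inv b by blast
  show "C \<subseteq> lam b ` C"
  proof
    fix x assume x: "x \<in> C"
    then have "x = lam b (lam (inv b) x)"
      using assms(1) b by (simp add: lam_lam lam_one subset_iff)
    moreover have "lam (inv b) x \<in> C" using x b inv by simp
    ultimately show "x \<in> lam b ` C" by blast
  qed
qed

text \<open>
  This is the largest left ideal inside a subgroup \<open>A\<close> of the additive group.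
\<close>

definition lam_core :: "'a set \<Rightarrow> 'a set"
  where "lam_core A = (\<Inter>b\<in>carrier B. lam b ` A)"

lemma lam_core_subset:
  assumes "A \<subseteq> carrier B"
  shows "lam_core A \<subseteq> A"
proof -
  have "lam \<one> ` A = A" using assms by (force simp: lam_one)
  then show ?thesis by (auto simp: lam_core_def)
qed

text \<open>
  The maps \<open>lam b\<close> permute the images of \<open>A\<close> that are intersected: the image under \<open>inv b \<otimes> d\<close>
  is carried to the image under \<open>d\<close>.
\<close>

lemma lam_core_invariant:
  assumes A: "A \<subseteq> carrier B" and b: "b \<in> carrier B" and x: "x \<in> lam_core A"
  shows "lam b x \<in> lam_core A"
  unfolding lam_core_def
proof
  fix d assume d: "d \<in> carrier B"
  then have "x \<in> lam (inv b \<otimes> d) ` A" using b x by (auto simp: lam_core_def)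
  then obtain a where a: "a \<in> A" "x = lam (inv b \<otimes> d) a" by blast
  then have "lam b x = lam d a"
    using A b d by (simp add: lam_lam m_assoc[symmetric] subset_iff)
  then show "lam b x \<in> lam d ` A" using a by blast
qed

lemma lam_core_subgroup:
  assumes "subgroup A (add_monoid B)"
  shows "subgroup (lam_core A) (add_monoid B)"
  unfolding lam_core_def
  using assms by (intro add.subgroups_Inter) (auto simp: lam_image_subgroup)

lemma finite_add_lcosets_lam_core:
  assumes A: "subgroup A (add_monoid B)"
    and fin_add: "finite (lcosets\<^bsub>add_monoid B\<^esub> A)" and fin_mult: "finite (lcosets A)"
  shows "finite (lcosets\<^bsub>add_monoid B\<^esub> (lam_core A))"
  unfolding lam_core_def
proof (rule add.finite_lcosets_Inter)
  show "finite ((\<lambda>b. lam b ` A) ` carrier B)" by (rule finite_lam_images[OF A fin_mult])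
  show "(\<lambda>b. lam b ` A) ` carrier B \<noteq> {}" by auto
next
  fix H assume "H \<in> (\<lambda>b. lam b ` A) ` carrier B"
  then obtain b where b: "b \<in> carrier B" "H = lam b ` A" by blast
  then show "subgroup H (add_monoid B)" using A by (simp add: lam_image_subgroup)
  show "finite (lcosets\<^bsub>add_monoid B\<^esub> H)"
    using b subgroup.subset[OF A] fin_add
    by (simp add: add.finite_lcosets_automorphic_image lam_hom lam_surj)
qed

lemma card_lcosets_eq:
  assumes A: "subgroup A (add_monoid B)" and A': "subgroup A B"
    and fin_add: "finite (lcosets\<^bsub>add_monoid B\<^esub> A)" and fin_mult: "finite (lcosets A)"
  shows "card (lcosets\<^bsub>add_monoid B\<^esub> A) = card (lcosets A)"
proof -
  have sub: "A \<subseteq> carrier B" by (rule subgroup.subset[OF A'])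
  define C where "C = lam_core A"
  have C: "subgroup C (add_monoid B)" using A by (simp add: C_def lam_core_subgroup)
  have CA: "C \<subseteq> A" using sub by (simp add: C_def lam_core_subset)
  have inv: "lam b x \<in> C" if "b \<in> carrier B" "x \<in> C" for b x
    using that sub by (simp add: C_def lam_core_invariant)
  have C': "subgroup C B" by (rule left_ideal_subgroup[OF C inv])
  have coset: "b <# C = b <#\<^bsub>add_monoid B\<^esub> C" if "b \<in> carrier B" for b
    using that CA sub left_ideal_lam_image[OF _ inv that] mult_lcoset_eq_add_lcoset[OF that, of C]
    by auto
  have cosets: "lcosets C = lcosets\<^bsub>add_monoid B\<^esub> C"
    by (simp add: LCOSETS_def coset)
  have cosets_in_A: "(\<lambda>h. h <# C) ` A = (\<lambda>h. h <#\<^bsub>add_monoid B\<^esub> C) ` A"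
    using sub coset by (intro image_cong) auto
  have "card (lcosets C) = card (lcosets A) * card ((\<lambda>h. h <# C) ` A)"
    by (rule card_lcosets_tower[OF A' C' CA])
  moreover have "card (lcosets C)
      = card (lcosets\<^bsub>add_monoid B\<^esub> A) * card ((\<lambda>h. h <# C) ` A)"
    using add.card_lcosets_tower[OF A C CA] by (simp add: cosets cosets_in_A)
  moreover have "finite (lcosets C)"
    using finite_add_lcosets_lam_core[OF A fin_add fin_mult] by (simp add: cosets) (simp add: C_def)
  then have "card (lcosets C) \<noteq> 0"
    by (auto simp: LCOSETS_def)
  ultimately show ?thesis by auto
qed

end

theorem theorem3p3:
  fixes B :: "('a, 'b) ring_scheme" and A :: "'a set"
  assumes "skew_brace B"
    and "sub_skew_brace A B"
    and "finite (a_rcosets\<^bsub>B\<^esub> A)"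
    and "finite (rcosets\<^bsub>B\<^esub> A)"
  shows "card (a_rcosets\<^bsub>B\<^esub> A) = card (rcosets\<^bsub>B\<^esub> A)"
proof -
  interpret skew_brace B by fact
  have A: "subgroup A (add_monoid B)" and A': "subgroup A B"
    using assms(2) by (auto simp: sub_skew_brace_def additive_subgroup_def)
  note add_bij = add.bij_betw_lcosets_rcosets[OF A, folded A_RCOSETS_def]
    and mult_bij = bij_betw_lcosets_rcosets[OF A']
  have "card (lcosets\<^bsub>add_monoid B\<^esub> A) = card (lcosets\<^bsub>B\<^esub> A)"
    using assms(3,4) bij_betw_finite[OF add_bij] bij_betw_finite[OF mult_bij]
    by (intro card_lcosets_eq[OF A A']) auto
  then show ?thesis
    using bij_betw_same_card[OF add_bij] bij_betw_same_card[OF mult_bij] by simp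
qed

end
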